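(* For any integer $n\geq 1$, the two-bridge knot $\mathbf{b}(2n+\frac12)$, regarded as a welded knot, has unknotting twist number one: $ut(\mathbf{b}(2n+\frac12))=1$.
   Context: A welded knot diagram is a generic immersion of one circle in the plane in which every double point is marked either as a classical crossing (with over/under information) or as a welded crossing (no over/under information). Welded Reidemeister moves are: the classical Reidemeister moves RI, RII, RIII; the moves VRI, VRII, VRIII (the versions of RI, RII, RIII in which all crossings are welded); the move SV (the Reidemeister-III-type move in which an arc having two welded crossings is moved across a classical crossing); and the move $F_1$ (the Reidemeister-III-type move in which an arc passing over two strands at two classical crossings is moved across the welded crossing of these two strands). Two diagrams are equivalent if related by a finite sequence of welded Reidemeister moves (and planar isotopy); a welded knot $K$ is an equivalence class, and $D\in[K]$ means that $D$ is a diagram of $K$. The trivial welded knot is the class of the diagram without crossings. A classical knot is regarded as a welded knot via any classical diagram of it. Equivalently, a diagram up to VRI, VRII, VRIII, SV is determined by its signed Gauss diagram (one arrow per classical crossing, from over- to under-passage, labelled by the sign of the crossing); $F_1$ exchanges two adjacent arrow tails. Twist move at a classical crossing $c$: replace a small neighbourhood of $c$, viewed as a 2-strand tangle consisting of the single crossing $c$, by the 2-strand tangle obtained by placing a welded crossing of the two strands on each of two opposite sides of the classical crossing (a vertical stack welded–classical–welded), the classical crossing being drawn with the same picture; the inverse replacement is also a twist move. It exchanges the over- and under-passing strands at $c$ while preserving the sign of $c$ (on the Gauss diagram: reverses the arrow of $c$, keeps its sign). Unknotting twist number: $ut(D)$ is the minimum number of twist moves (applied at classical crossings of $D$) required to change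 $D$ into a diagram of the trivial welded knot, and $ut(K)=\min\{ut(D)\mid D\in[K]\}$. $\mathbf{b}(2n+\frac12)$ denotes the two-bridge knot with rational parameter $2n+\frac12=\frac{4n+1}{2}$, i.e. the knot with Conway notation $C(2n,2)$: the alternating twist knot with $2n+2$ crossings consisting of a row of $2n$ half-twists closed by a 2-crossing clasp (for $n=1$ the figure-eight knot $4_1$, for $n=2$ the knot $6_1$, for $n=3$ the knot $8_1$). *)

theory Defs
  imports Main "HOL-Library.Extended_Nat"
begin

(* Planar diagrams are written in Morse position with respect to the height function: a diagram
   is read from top to bottom as a list of events (p, i), where i is the number of strands to the
   left of the piece p at that height.  Cap is a local maximum, Cup a local minimum.  In a crossing
   one strand runs from top left to bottom right (falling) and the other one from top right to
   bottom left (rising); the marking names the over-strand, or says that the crossing is welded.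
   Everything is unoriented. *)

datatype marking = Falling | Rising | Welded

datatype piece = Cap | Cup | Cross marking

type_synonym event = "piece \<times> nat"
type_synonym diagram = "event list"

fun tops :: "piece \<Rightarrow> nat" where
  "tops Cap = 0"
| "tops Cup = 2"
| "tops (Cross m) = 2"

fun bottoms :: "piece \<Rightarrow> nat" where
  "bottoms Cap = 2"
| "bottoms Cup = 0"
| "bottoms (Cross m) = 2"

(* Number of strands below the events, given w strands above them; None if the indices do
   not fit. *)
fun strands :: "nat \<Rightarrow> diagram \<Rightarrow> nat option" where
  "strands w [] = Some w"
| "strands w ((p, i) # D) =
     (if i + tops p \<le> w then strands (w - tops p + bottoms p) D else None)"

(* Any number of components. *)
definition link_diagram :: "diagram \<Rightarrow> bool" where
  "link_diagram D \<longleftrightarrow> strands 0 D = Some 0"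

(* The point (k, q) is the q-th strand (from the left) on the horizontal line below the first k
   events. *)
definition points :: "diagram \<Rightarrow> (nat \<times> nat) set" where
  "points D = {(k, q). k \<le> length D \<and> q < the (strands 0 (take k D))}"

(* Two points cut out a piece of the curve without further points on it. *)
inductive joined :: "diagram \<Rightarrow> nat \<times> nat \<Rightarrow> nat \<times> nat \<Rightarrow> bool" for D where
  left: "k < length D \<Longrightarrow> D ! k = (p, i) \<Longrightarrow> q < i \<Longrightarrow> joined D (k, q) (Suc k, q)"
| right: "k < length D \<Longrightarrow> D ! k = (p, i) \<Longrightarrow>
     joined D (k, i + tops p + q) (Suc k, i + bottoms p + q)"
| cap: "k < length D \<Longrightarrow> D ! k = (Cap, i) \<Longrightarrow> joined D (Suc k, i) (Suc k, Suc i)"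
| cup: "k < length D \<Longrightarrow> D ! k = (Cup, i) \<Longrightarrow> joined D (k, i) (k, Suc i)"
| falling: "k < length D \<Longrightarrow> D ! k = (Cross m, i) \<Longrightarrow> joined D (k, i) (Suc k, Suc i)"
| rising: "k < length D \<Longrightarrow> D ! k = (Cross m, i) \<Longrightarrow> joined D (k, Suc i) (Suc k, i)"

(* The immersed curve is a single circle. *)
definition knot_diagram :: "diagram \<Rightarrow> bool" where
  "knot_diagram D \<longleftrightarrow> link_diagram D \<and> D \<noteq> [] \<and>
     (\<forall>x \<in> points D. \<forall>y \<in> points D. equivclp (joined D) x y)"

(* Swaps the roles of the two strands. *)
fun flip :: "marking \<Rightarrow> marking" where
  "flip Falling = Rising"
| "flip Rising = Falling"
| "flip Welded = Welded"

(* Planar isotopy of diagrams in Morse position: interchanging the heights of two pieces lying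
   side by side (f is to the right of e, with k strands in between), cancelling a maximum with a
   minimum, and sliding a crossing over an extremum (which amounts to rotating the crossing). *)
inductive isotopy_rule :: "diagram \<Rightarrow> diagram \<Rightarrow> bool" where
  interchange: "isotopy_rule [(f, i + tops e + k), (e, i)] [(e, i), (f, i + bottoms e + k)]"
| zigzag1: "isotopy_rule [(Cap, i), (Cup, Suc i)] []"
| zigzag2: "isotopy_rule [(Cap, Suc i), (Cup, i)] []"
| slide_cap: "isotopy_rule [(Cap, i), (Cross m, Suc i)] [(Cap, Suc i), (Cross (flip m), i)]"
| slide_cup: "isotopy_rule [(Cross m, Suc i), (Cup, i)] [(Cross (flip m), i), (Cup, Suc i)]"

(* The moves RI and VRI are stated as the removal of a half-twist from an extremum.  Every version
   of RI, RII and of the triangle moves is obtained from the given ones up to planar isotopy.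
   In the triangle moves, number the three strands 1, 2, 3 from left to right at the top.  Then
   a, b, c are the markings of the crossings of the strands 1 and 2, 1 and 3, 2 and 3, and in each
   crossing the falling strand is the one with the smaller number. *)
inductive reidemeister_rule :: "diagram \<Rightarrow> diagram \<Rightarrow> bool" where
  RI_cap: "m \<noteq> Welded \<Longrightarrow> reidemeister_rule [(Cap, i), (Cross m, i)] [(Cap, i)]"
| RI_cup: "m \<noteq> Welded \<Longrightarrow> reidemeister_rule [(Cross m, i), (Cup, i)] [(Cup, i)]"
| RII: "m \<noteq> Welded \<Longrightarrow> reidemeister_rule [(Cross m, i), (Cross (flip m), i)] []"
  (* the excluded markings have 1 over 2 over 3 over 1 or the reverse *)
| RIII: "a \<noteq> Welded \<Longrightarrow> b \<noteq> Welded \<Longrightarrow> c \<noteq> Welded \<Longrightarrow> \<not> (a = c \<and> b \<noteq> a) \<Longrightarrow>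
     reidemeister_rule [(Cross a, i), (Cross b, Suc i), (Cross c, i)]
                       [(Cross c, Suc i), (Cross b, i), (Cross a, Suc i)]"
| VRI_cap: "reidemeister_rule [(Cap, i), (Cross Welded, i)] [(Cap, i)]"
| VRI_cup: "reidemeister_rule [(Cross Welded, i), (Cup, i)] [(Cup, i)]"
| VRII: "reidemeister_rule [(Cross Welded, i), (Cross Welded, i)] []"
| VRIII: "reidemeister_rule [(Cross Welded, i), (Cross Welded, Suc i), (Cross Welded, i)]
                            [(Cross Welded, Suc i), (Cross Welded, i), (Cross Welded, Suc i)]"
| SV: "m \<noteq> Welded \<Longrightarrow>
     (a, b, c) \<in> {(m, Welded, Welded), (Welded, m, Welded), (Welded, Welded, m)} \<Longrightarrow>
     reidemeister_rule [(Cross a, i), (Cross b, Suc i), (Cross c, i)]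
                       [(Cross c, Suc i), (Cross b, i), (Cross a, Suc i)]"
  (* the strand passing over the other two is 1, 2, 3, respectively *)
| F1: "(a, b, c) \<in> {(Falling, Falling, Welded), (Rising, Welded, Falling),
                    (Welded, Rising, Rising)} \<Longrightarrow>
     reidemeister_rule [(Cross a, i), (Cross b, Suc i), (Cross c, i)]
                       [(Cross c, Suc i), (Cross b, i), (Cross a, Suc i)]"

(* The vertical stack; the horizontal one arises from it by rotating the crossing, since the twist
   move below is taken up to planar isotopy. *)
inductive twist_rule :: "diagram \<Rightarrow> diagram \<Rightarrow> bool" where
  twist: "m \<noteq> Welded \<Longrightarrow>
     twist_rule [(Cross m, i)] [(Cross Welded, i), (Cross m, i), (Cross Welded, i)]"

definition apply_rule :: "(diagram \<Rightarrow> diagram \<Rightarrow> bool) \<Rightarrow> diagram \<Rightarrow> diagram \<Rightarrow> bool" where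
  "apply_rule R D D' \<longleftrightarrow> link_diagram D \<and> link_diagram D' \<and>
     (\<exists>xs l r ys. R l r \<and> D = xs @ l @ ys \<and> D' = xs @ r @ ys)"

definition planar_isotopic :: "diagram \<Rightarrow> diagram \<Rightarrow> bool" where
  "planar_isotopic = equivclp (apply_rule isotopy_rule)"

(* All moves preserve the number of components, so for knot diagrams it makes no difference that
   the intermediate diagrams are only required to be link diagrams. *)
definition welded_equivalent :: "diagram \<Rightarrow> diagram \<Rightarrow> bool" where
  "welded_equivalent = equivclp (apply_rule (\<lambda>l r. isotopy_rule l r \<or> reidemeister_rule l r))"

(* The welded knot represented by D, as the set of its diagrams. *)
definition welded_class :: "diagram \<Rightarrow> diagram set" where
  "welded_class D = {D'. knot_diagram D' \<and> welded_equivalent D D'}"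

definition trivial_diagram :: diagram where
  "trivial_diagram = [(Cap, 0), (Cup, 0)]"

definition twist_move :: "diagram \<Rightarrow> diagram \<Rightarrow> bool" where
  "twist_move D D' \<longleftrightarrow> (\<exists>E E'. planar_isotopic D E \<and>
     (apply_rule twist_rule E E' \<or> apply_rule twist_rule E' E) \<and> planar_isotopic E' D')"

definition ut_diagram :: "diagram \<Rightarrow> enat" where
  "ut_diagram D =
     (INF k \<in> {k. \<exists>D'. (twist_move ^^ k) D D' \<and> welded_equivalent trivial_diagram D'}. enat k)"

definition ut :: "diagram set \<Rightarrow> enat" where
  "ut K = (INF D \<in> K. ut_diagram D)"

(* The standard alternating 4-plat diagram with Conway notation C(a, b), a and b even, i.e. of
   the two-bridge knot with rational parameter a + 1/b: a half-twists between the two middle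
   strands, closed by b half-twists of the two left strands.  All crossings of the a-row have the
   opposite marking to those of the b-row, so that the diagram alternates.  The mirror image of a
   knot (all classical markings flipped) has the same unknotting twist number, hence the choice of
   handedness is immaterial. *)
definition two_bridge_diagram :: "nat \<Rightarrow> nat \<Rightarrow> diagram" where
  "two_bridge_diagram a b =
     [(Cap, 0), (Cap, 2)] @ replicate a (Cross Falling, 1) @ replicate b (Cross Rising, 0) @
     [(Cup, 1), (Cup, 0)]"

end

theory Submission
  imports Defs
begin

text \<open>Let \<open>K\<close> be the twist knot with a row of \<open>2n\<close> half-twists and a clasp of two crossings.

  One twist move suffices. The diagram alternates, so each of the two strands of the clasp passes over once and
  under once. Twisting one clasp crossing reverses its arrow in the Gauss diagram, and then one strand of the
  clasp contains both arrow tails while the other one contains both heads. The last crossing of the row is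
  a self-crossing of the curve bounding a loop that consists of the over-strand of the clasp. Only tails lie on
  this loop, and \<open>F1\<close> permits the tail of the self-crossing to pass them, so it becomes a kink and is
  removed by \<open>RI\<close>. The preceding crossing then bounds the same loop, so the row disappears crossing by crossing
  (\<open>absorb_row\<close>), after which the crossings of the clasp are kinks themselves (\<open>split_clasp_trivial\<close>).
  Among Morse diagrams, an arrow of the row disappears by being replaced with a welded crossing,
  so half-twists are removed in pairs, and this needs two versions of the loop argument, one for each direction of the
  arrow (\<open>loop_right\<close> and \<open>loop_left\<close>).

  Without a twist the knot is not trivial. Fox colourings modulo \<open>p\<close> satisfy the welded moves if welded crossings are
  ignored: \<open>F1\<close> holds because an over-strand acts on each strand below it separately. Hence their number is an
  invariant (\<open>welded_equivalent_colourings\<close>). For the determinant \<open>p = 4n + 1\<close> of \<open>K\<close> the diagram of \<open>K\<close> has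
  \<open>p\<^sup>2\<close> colourings, whereas the trivial diagram has \<open>p\<close>.\<close>

section \<open>Strand counts\<close>

lemma strands_append:
  "strands w (xs @ ys) = (case strands w xs of None \<Rightarrow> None | Some v \<Rightarrow> strands v ys)"
  by (induction xs arbitrary: w) auto

lemma strands_row: "strands 4 (replicate k (Cross m, 1)) = Some 4"
  by (induction k) auto

section \<open>Fox colourings\<close>

text \<open>The Fox rule of the dihedral quandle \<open>\<int>/p\<close>, with residues represented in \<open>{0..<p}\<close>: a strand with colour
  \<open>b\<close> leaves an underpass below \<open>a\<close> with the colour \<open>2a - b\<close>, and nothing happens at a
  welded crossing. The values are sets because a maximum admits many colours below it and a minimum may
  admit none.\<close>

fun bottom_colours :: "int \<Rightarrow> piece \<Rightarrow> int list \<Rightarrow> int list set" where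
  "bottom_colours p Cap A = (\<lambda>c. [c, c]) ` {0..<p}"
| "bottom_colours p Cup A = (if A ! 0 = A ! Suc 0 then {[]} else {})"
| "bottom_colours p (Cross Falling) A = {[(2 * A ! 0 - A ! Suc 0) mod p, A ! 0]}"
| "bottom_colours p (Cross Rising) A = {[A ! Suc 0, (2 * A ! Suc 0 - A ! 0) mod p]}"
| "bottom_colours p (Cross Welded) A = {[A ! Suc 0, A ! 0]}"

text \<open>Counting by recursion over the events makes every local move a statement about functions of the
  colours on the strands entering from above, so that the moves need not be analysed within a whole diagram.\<close>

fun colourings :: "int \<Rightarrow> diagram \<Rightarrow> int list \<Rightarrow> nat" where
  "colourings p [] xs = (if xs = [] then 1 else 0)"
| "colourings p ((e, i) # D) xs =
     (\<Sum>B \<in> bottom_colours p e (take (tops e) (drop i xs)).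
        colourings p D (take i xs @ B @ drop (i + tops e) xs))"

lemma colourings_append:
  assumes "length us = i" "length A = tops e"
  shows "colourings p ((e, i) # D) (us @ A @ vs) =
    (\<Sum>B \<in> bottom_colours p e A. colourings p D (us @ B @ vs))"
  using assms by simp

lemma bottom_colours_range:
  assumes "p > 0" "length A = tops e" "set A \<subseteq> {0..<p}" "B \<in> bottom_colours p e A"
  shows "length B = bottoms e" "set B \<subseteq> {0..<p}"
proof -
  have "length B = bottoms e \<and> set B \<subseteq> {0..<p}"
  proof (cases e)
    case (Cross m)
    then obtain x y where "A = [x, y]"
      using assms(2) by (auto simp: length_Suc_conv numeral_2_eq_2)
    then show ?thesis using assms Cross by (cases m) auto
  qed (use assms in \<open>auto split: if_splits\<close>)
  then show "length B = bottoms e" "set B \<subseteq> {0..<p}" by auto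
qed

lemma colourings_Cap:
  "length us = i \<Longrightarrow> colourings p ((Cap, i) # D) (us @ vs) = (\<Sum>c = 0..<p. colourings p D (us @ c # c # vs))"
  using colourings_append[of us i "[]" Cap p D vs]
  by (simp add: sum.reindex inj_on_def del: colourings.simps)

lemma colourings_Cup:
  "length us = i \<Longrightarrow> colourings p ((Cup, i) # D) (us @ x # y # vs) = (if x = y then colourings p D (us @ vs) else 0)"
  using colourings_append[of us i "[x, y]" Cup p D vs]
  by (simp del: colourings.simps)

text \<open>Colours coming from above through a common prefix are arbitrary residues, so two diagrams that have
  equally many colourings for all top colours can replace each other below any prefix.\<close>

lemma colourings_cong_prefix:
  assumes p: "p > 0"
    and eq: "\<And>zs. length zs = v \<Longrightarrow> set zs \<subseteq> {0..<p} \<Longrightarrow> colourings p D zs = colourings p E zs"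
  shows "strands w xs = Some v \<Longrightarrow> length zs = w \<Longrightarrow> set zs \<subseteq> {0..<p} \<Longrightarrow>
    colourings p (xs @ D) zs = colourings p (xs @ E) zs"
proof (induction xs arbitrary: w zs)
  case Nil
  then show ?case using eq by simp
next
  case (Cons a xs)
  obtain e i where a: "a = (e, i)" by (cases a)
  have w: "i + tops e \<le> w" and s: "strands (w - tops e + bottoms e) xs = Some v"
    using Cons.prems(1) by (auto simp: a split: if_splits)
  define us A vs where "us = take i zs" and "A = take (tops e) (drop i zs)"
    and "vs = drop (i + tops e) zs"
  have zs: "zs = us @ A @ vs"
    unfolding us_def A_def vs_def
    by (metis add.commute append_take_drop_id drop_drop)
  have l: "length us = i" "length A = tops e" "length vs = w - i - tops e"
    using w Cons.prems(2) by (auto simp: us_def A_def vs_def)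
  have "colourings p (xs @ D) (us @ B @ vs) = colourings p (xs @ E) (us @ B @ vs)"
    if "B \<in> bottom_colours p e A" for B
  proof (rule Cons.IH[OF s])
    have B: "length B = bottoms e" "set B \<subseteq> {0..<p}"
      using bottom_colours_range[OF p l(2) _ that] Cons.prems(3) zs by auto
    show "length (us @ B @ vs) = w - tops e + bottoms e" using B l w by simp
    show "set (us @ B @ vs) \<subseteq> {0..<p}" using B Cons.prems(3) zs by auto
  qed
  then show ?case
    unfolding a zs append_Cons colourings_append[OF l(1,2)] by (intro sum.cong) auto
qed

lemma split_list_at:
  assumes "i + k \<le> length zs"
  obtains us A vs where "zs = us @ A @ vs" "length us = i" "length A = k"
proof
  show "zs = take i zs @ take k (drop i zs) @ drop (i + k) zs"
    by (metis add.commute append_take_drop_id drop_drop)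
qed (use assms in auto)

lemma split_list_at1:
  assumes "Suc i \<le> length zs"
  obtains us x vs where "zs = us @ x # vs" "length us = i"
proof -
  obtain us A vs where "zs = us @ A @ vs" "length us = i" "length A = 1"
    using split_list_at[of i 1 zs] assms by auto
  then show thesis using that by (auto simp: length_Suc_conv One_nat_def)
qed

lemma split_list_at2:
  assumes "Suc (Suc i) \<le> length zs"
  obtains us x y vs where "zs = us @ x # y # vs" "length us = i"
proof -
  obtain us A vs where "zs = us @ A @ vs" "length us = i" "length A = 2"
    using split_list_at[of i 2 zs] assms by auto
  then show thesis using that by (auto simp: length_Suc_conv numeral_2_eq_2)
qed

lemma split_list_at3:
  assumes "Suc (Suc (Suc i)) \<le> length zs"
  obtains us x y z vs where "zs = us @ x # y # z # vs" "length us = i"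
proof -
  obtain us A vs where "zs = us @ A @ vs" "length us = i" "length A = 3"
    using split_list_at[of i 3 zs] assms by auto
  then show thesis using that by (auto simp: length_Suc_conv numeral_3_eq_3)
qed

lemma dihedral_eq_iff:
  fixes x y z p :: int
  assumes "x \<in> {0..<p}" "z \<in> {0..<p}"
  shows "x = (2 * y - z) mod p \<longleftrightarrow> (2 * y - x) mod p = z"
proof -
  have "(2 * y - (2 * y - w) mod p) mod p = w" if "w \<in> {0..<p}" for w
    using that by (simp add: mod_diff_right_eq)
  then show ?thesis using assms by metis
qed

lemma dihedral_involution:
  fixes x y p :: int
  assumes "y \<in> {0..<p}"
  shows "(2 * x - (2 * x - y) mod p) mod p = y"
  using assms by (simp add: mod_diff_right_eq)

lemma dihedral_mod:
  fixes a b p :: int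
  shows "(2 * (a mod p) - b) mod p = (2 * a - b) mod p"
  by (metis mod_diff_left_eq mod_mult_right_eq)

text \<open>Both laws are self-distributivity of the operation \<open>(x, y) \<mapsto> 2x - y\<close>: the second is the first with the
  involution in \<open>x\<close> applied. They are what the triangle moves amount to.\<close>

lemma dihedral_distrib:
  fixes x y z p :: int
  shows "(2 * ((2 * x - y) mod p) - (2 * x - z) mod p) mod p = (2 * x - (2 * y - z) mod p) mod p"
    and "(2 * x - (2 * ((2 * x - y) mod p) - z) mod p) mod p = (2 * y - (2 * x - z) mod p) mod p"
  by (simp_all add: dihedral_mod mod_diff_right_eq) (simp_all add: algebra_simps)

lemma dihedral_fixed:
  fixes x y p :: int
  assumes "x \<in> {0..<p}" "y \<in> {0..<p}"
  shows "(2 * x - y) mod p = x \<longleftrightarrow> x = y"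
proof -
  have "(2 * x - y) mod p = x mod p \<longleftrightarrow> x mod p = y mod p"
    by (simp add: mod_eq_dvd_iff)
  then show ?thesis using assms by simp
qed

text \<open>When a crossing slides over a maximum as the over-strand changes sides, the free colour of the maximum is
  replaced by its reflection; reflections permute the residues.\<close>

lemma sum_dihedral:
  fixes x p :: int
  assumes "p > 0"
  shows "(\<Sum>c = 0..<p. f c ((2 * x - c) mod p)) = (\<Sum>c = 0..<p. f ((2 * x - c) mod p) c)"
  by (rule sum.reindex_bij_witness[where i = "\<lambda>c. (2 * x - c) mod p" and j = "\<lambda>c. (2 * x - c) mod p"])
    (use assms dihedral_involution in auto)

lemma isotopy_colourings:
  assumes "isotopy_rule l r" "p > 0" "strands w l \<noteq> None" "length zs = w" "set zs \<subseteq> {0..<p}"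
  shows "colourings p (l @ ys) zs = colourings p (r @ ys) zs"
  using assms(1)
proof cases
  case (interchange f i e k)
  have "i + tops e + k + tops f \<le> length zs"
    using assms(3,4) interchange by (auto split: if_splits)
  then obtain us1 B vs where 1: "zs = us1 @ B @ vs" "length us1 = i + tops e + k" "length B = tops f"
    using split_list_at by metis
  then obtain us A ms where 2: "us1 = us @ A @ ms" "length us = i" "length A = tops e"
    using split_list_at[of i "tops e" us1] by auto
  then have ms: "length ms = k" using 1 by simp
  have "colourings p (l @ ys) zs =
     (\<Sum>B' \<in> bottom_colours p f B. \<Sum>A' \<in> bottom_colours p e A. colourings p ys (us @ A' @ ms @ B' @ vs))"
    unfolding interchange append_Cons append_Nil 1(1) colourings_append[OF 1(2,3)]
    unfolding 2(1) append_assoc colourings_append[OF 2(2,3)] ..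
  also have "\<dots> = (\<Sum>A' \<in> bottom_colours p e A. \<Sum>B' \<in> bottom_colours p f B. colourings p ys (us @ A' @ ms @ B' @ vs))"
    by (rule sum.swap)
  also have "\<dots> = (\<Sum>A' \<in> bottom_colours p e A.
      colourings p ((f, i + bottoms e + k) # ys) ((us @ A' @ ms) @ B @ vs))"
  proof (rule sum.cong[OF refl])
    fix A' assume "A' \<in> bottom_colours p e A"
    then have "length A' = bottoms e"
      using bottom_colours_range(1)[OF assms(2) 2(3)] assms(5) 1(1) 2(1) by auto
    then have "length (us @ A' @ ms) = i + bottoms e + k" using ms 2 by simp
    from colourings_append[OF this 1(3)]
    show "(\<Sum>B' \<in> bottom_colours p f B. colourings p ys (us @ A' @ ms @ B' @ vs)) =
        colourings p ((f, i + bottoms e + k) # ys) ((us @ A' @ ms) @ B @ vs)" by simp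
  qed
  also have "\<dots> = colourings p (r @ ys) zs"
    unfolding interchange append_Cons append_Nil 1(1) 2(1) append_assoc colourings_append[OF 2(2,3)] ..
  finally show ?thesis .
next
  case (zigzag1 i)
  obtain us x vs where zs: "zs = us @ x # vs" "length us = i"
    using split_list_at1[of i zs] assms(3,4) zigzag1 by (auto split: if_splits)
  have "colourings p (l @ ys) zs = (\<Sum>c = 0..<p. colourings p ((Cup, Suc i) # ys) ((us @ [c]) @ c # x # vs))"
    unfolding zigzag1 zs append_Cons append_Nil colourings_Cap[OF zs(2)] by simp
  also have "\<dots> = (\<Sum>c = 0..<p. if c = x then colourings p ys (us @ c # vs) else 0)"
    by (subst colourings_Cup) (use zs in \<open>auto intro!: sum.cong\<close>)
  also have "\<dots> = colourings p (r @ ys) zs"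
    using assms(5) by (simp add: zigzag1 zs)
  finally show ?thesis .
next
  case (zigzag2 i)
  obtain us x vs where zs: "zs = us @ x # vs" "length us = i"
    using split_list_at1[of i zs] assms(3,4) zigzag2 by (auto split: if_splits)
  have "colourings p (l @ ys) zs = colourings p ((Cap, Suc i) # (Cup, i) # ys) ((us @ [x]) @ vs)"
    by (simp add: zigzag2 zs del: colourings.simps)
  also have "\<dots> = (\<Sum>c = 0..<p. colourings p ((Cup, i) # ys) (us @ x # c # c # vs))"
    by (subst colourings_Cap) (use zs in \<open>simp_all del: colourings.simps\<close>)
  also have "\<dots> = (\<Sum>c = 0..<p. if x = c then colourings p ys (us @ c # vs) else 0)"
    by (subst colourings_Cup) (use zs in \<open>auto intro!: sum.cong\<close>)
  also have "\<dots> = colourings p (r @ ys) zs"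
    using assms(5) by (simp add: zigzag2 zs)
  finally show ?thesis .
next
  case (slide_cap i m)
  obtain us x vs where zs: "zs = us @ x # vs" "length us = i"
    using split_list_at1[of i zs] assms(3,4) slide_cap by (auto split: if_splits)
  have l: "colourings p (l @ ys) zs = (\<Sum>c = 0..<p. colourings p ((Cross m, Suc i) # ys) (us @ c # c # x # vs))"
    using zs by (simp add: slide_cap colourings_Cap del: colourings.simps)
  have r: "colourings p (r @ ys) zs = (\<Sum>c = 0..<p. colourings p ((Cross (flip m), i) # ys) (us @ x # c # c # vs))"
    using zs colourings_Cap[of "us @ [x]" "Suc i" p _ vs]
    by (simp add: slide_cap del: colourings.simps)
  show ?thesis unfolding l r using zs(2) sum_dihedral[OF assms(2), of "\<lambda>c d. colourings p ys (us @ c # x # d # vs)" x]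
    by (cases m) simp_all
next
  case (slide_cup m i)
  have "Suc (Suc (Suc i)) \<le> length zs"
    using assms(3,4) slide_cup by (auto split: if_splits)
  then obtain us x y z vs where zs: "zs = us @ x # y # z # vs" "length us = i"
    using split_list_at3 by blast
  then show ?thesis using assms(5) dihedral_eq_iff[of x p z y]
    by (cases m) (auto simp: slide_cup nth_append)
qed

text \<open>Since the colouring rule ignores welded crossings, each triangle move reduces to self-distributivity or is
  trivial. The move \<open>F1\<close> holds because the over-strand keeps its colour and acts on the two other strands
  separately. The set \<open>S\<close> below lists all markings of triangle moves.\<close>

lemma reidemeister_colourings:
  assumes "reidemeister_rule l r" "p > 0" "strands w l \<noteq> None" "length zs = w" "set zs \<subseteq> {0..<p}"
  shows "colourings p (l @ ys) zs = colourings p (r @ ys) zs"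
proof -
  have cap: "colourings p ((Cap, i) # (Cross m, i) # ys) zs = colourings p ((Cap, i) # ys) zs"
    if "i \<le> length zs" for i m
  proof -
    define us vs where "us = take i zs" and "vs = drop i zs"
    then have zs: "zs = us @ vs" "length us = i"
      using \<open>i \<le> length zs\<close> by simp_all
    have "colourings p ((Cross m, i) # ys) (us @ c # c # vs) = colourings p ys (us @ c # c # vs)"
      if "c \<in> {0..<p}" for c
      using that zs(2) by (cases m) (simp_all add: nth_append)
    then show ?thesis
      unfolding zs(1) colourings_Cap[OF zs(2)] by (simp del: colourings.simps)
  qed
  have cup: "colourings p ((Cross m, i) # (Cup, i) # ys) zs = colourings p ((Cup, i) # ys) zs"
    if "Suc (Suc i) \<le> length zs" for i m
  proof -
    obtain us x y vs where zs: "zs = us @ x # y # vs" "length us = i"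
      using \<open>Suc (Suc i) \<le> length zs\<close> split_list_at2 by blast
    then have "(2 * x - y) mod p = x \<longleftrightarrow> x = y" "y = (2 * y - x) mod p \<longleftrightarrow> x = y"
      using assms(5) dihedral_fixed[of x p y] dihedral_fixed[of y p x] by auto
    then show ?thesis using zs by (cases m) (simp_all add: nth_append eq_commute)
  qed
  have two: "colourings p ((Cross m, i) # (Cross (flip m), i) # ys) zs = colourings p ys zs"
    if "Suc (Suc i) \<le> length zs" for i m
  proof -
    obtain us x y vs where zs: "zs = us @ x # y # vs" "length us = i"
      using \<open>Suc (Suc i) \<le> length zs\<close> split_list_at2 by blast
    then have "(2 * x - (2 * x - y) mod p) mod p = y" "(2 * y - (2 * y - x) mod p) mod p = x"
      using assms(5) dihedral_involution by auto
    then show ?thesis using zs by (cases m) (simp_all add: nth_append)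
  qed
  have three: "colourings p ((Cross a, i) # (Cross b, Suc i) # (Cross c, i) # ys) zs =
      colourings p ((Cross c, Suc i) # (Cross b, i) # (Cross a, Suc i) # ys) zs"
    if i: "Suc (Suc (Suc i)) \<le> length zs" and abc: "(a, b, c) \<in> S"
    and S: "S = {(Falling, Falling, Falling), (Falling, Falling, Rising), (Falling, Rising, Rising),
       (Rising, Falling, Falling), (Rising, Rising, Falling), (Rising, Rising, Rising),
       (Welded, Welded, Welded), (Falling, Welded, Welded), (Welded, Falling, Welded), 
       (Welded, Welded, Falling), (Rising, Welded, Welded), (Welded, Rising, Welded), 
       (Welded, Welded, Rising), 
       (Falling, Falling, Welded), (Rising, Welded, Falling), (Welded, Rising, Rising)}" for a b c i S
  proof -
    obtain us x y z vs where zs: "zs = us @ x # y # z # vs" "length us = i"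
      using i split_list_at3 by blast
    from abc show ?thesis unfolding S insert_iff empty_iff prod.inject
      by (elim disjE conjE FalseE; hypsubst)
        (simp_all add: zs nth_append dihedral_distrib del: prod.inject)
  qed
  from assms(1) show ?thesis
  proof cases
    case (RIII a b c i)
    then show ?thesis using assms(3,4) three[of i a b c, OF _ _ refl]
      by (cases a; cases b; cases c) (simp_all split: if_splits del: colourings.simps)
  next
    case (SV m a b c i)
    then show ?thesis using assms(3,4) three[of i a b c, OF _ _ refl]
      by (cases m) (auto split: if_splits simp del: colourings.simps)
  next
    case (F1 a b c i)
    then show ?thesis using assms(3,4) three[of i a b c, OF _ _ refl]
      by (auto split: if_splits simp del: colourings.simps)
  next
    case (VRII i)
    then show ?thesis using assms(3,4) two[of i Welded]
      by (auto split: if_splits simp del: colourings.simps)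
  next
    case (VRIII i)
    then show ?thesis using assms(3,4) three[of i Welded Welded Welded, OF _ _ refl]
      by (auto split: if_splits simp del: colourings.simps)
  qed (use assms(3,4) cap cup two in \<open>auto split: if_splits simp del: colourings.simps\<close>)
qed

lemma welded_equivalent_colourings:
  assumes "p > 0" "welded_equivalent D E"
  shows "colourings p D [] = colourings p E []"
proof -
  have invariant: "colourings p D [] = colourings p E []"
    if step: "apply_rule (\<lambda>l r. isotopy_rule l r \<or> reidemeister_rule l r) D E" for D E
  proof -
    obtain xs l r ys where *: "isotopy_rule l r \<or> reidemeister_rule l r" "D = xs @ l @ ys" "E = xs @ r @ ys"
      "strands 0 D = Some 0"
      using step unfolding apply_rule_def link_diagram_def by blast
    then obtain v where v: "strands 0 xs = Some v" "strands v l \<noteq> None"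
      by (auto simp: strands_append split: option.splits)
    have local: "colourings p (l @ ys) zs = colourings p (r @ ys) zs"
      if "length zs = v" "set zs \<subseteq> {0..<p}" for zs
      using *(1)
    proof
      assume "isotopy_rule l r"
      from isotopy_colourings[OF this assms(1) v(2) that] show ?thesis .
    next
      assume "reidemeister_rule l r"
      from reidemeister_colourings[OF this assms(1) v(2) that] show ?thesis .
    qed
    show ?thesis
      unfolding *(2,3) by (rule colourings_cong_prefix[OF assms(1) local v(1)]) simp_all
  qed
  from assms(2)[unfolded welded_equivalent_def] show ?thesis
  proof (induction rule: equivclp_induct)
    case (step F G)
    from step.hyps(2) have "colourings p F [] = colourings p G []"
      by (elim disjE) (simp_all only: invariant)
    then show ?case using step.IH by simp
  qed simp
qed

text \<open>A half-twist turns the colours \<open>(x, y)\<close> into \<open>(x + d, y + d)\<close> with \<open>d = x - y\<close>, so the difference persists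
  along the row.\<close>

lemma colourings_row:
  "colourings p (replicate k (Cross Falling, 1) @ D) [a, x mod p, y mod p, b] =
   colourings p D [a, (x + int k * (x - y)) mod p, (y + int k * (x - y)) mod p, b]"
proof (induction k arbitrary: x y)
  case 0
  then show ?case by simp
next
  case (Suc k)
  have "colourings p (replicate (Suc k) (Cross Falling, 1) @ D) [a, x mod p, y mod p, b] =
     colourings p (replicate k (Cross Falling, 1) @ D) [a, (2 * x - y) mod p, x mod p, b]"
    by (simp add: dihedral_mod mod_diff_right_eq)
  also have "\<dots> = colourings p D [a, (x + int (Suc k) * (x - y)) mod p, (y + int (Suc k) * (x - y)) mod p, b]"
    unfolding Suc.IH by (simp add: algebra_simps)
  finally show ?case .
qed

text \<open>The modulus is the determinant \<open>4n + 1\<close> of the knot, so that both minima at the bottom close up for every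
  choice of the colours \<open>a\<close> and \<open>b\<close> of the two maxima.\<close>

lemma colourings_two_bridge:
  assumes "p = 4 * int n + 1"
  shows "colourings p (two_bridge_diagram (2 * n) 2) [] = nat p * nat p"
proof -
  have "colourings p (replicate (2 * n) (Cross Falling, 1) @ replicate 2 (Cross Rising, 0) @ [(Cup, 1), (Cup, 0)])
      [a, a, b, b] = 1" (is "?c = 1") if "a \<in> {0..<p}" "b \<in> {0..<p}" for a b
  proof -
    \<comment> \<open>the colour of the second strand below the row\<close>
    define u where "u = a + 2 * int n * (a - b)"
    have 2: "(b + 2 * int n * (a - b)) mod p = (2 * b - u) mod p"
      "(2 * u - a) mod p = b"
    proof -
      have "b + 2 * int n * (a - b) = 2 * b - u + (a - b) * p"
        "2 * u - a = b + (a - b) * p" unfolding u_def assms by (simp_all add: algebra_simps)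
      then show "(b + 2 * int n * (a - b)) mod p = (2 * b - u) mod p" "(2 * u - a) mod p = b"
        using that by (simp_all only: mod_mult_self1) simp
    qed
    have "?c = colourings p (replicate 2 (Cross Rising, 0) @ [(Cup, 1), (Cup, 0)]) [a, u mod p, (2 * b - u) mod p, b]"
      using colourings_row[of p "2 * n" _ a a b b] that 2 by (simp add: u_def)
    also have "\<dots> = 1" using that 2(2)
      by (simp add: numeral_2_eq_2 dihedral_mod mod_diff_right_eq)
    finally show ?thesis .
  qed
  then have "(\<Sum>a = 0..<p. \<Sum>b = 0..<p. colourings p (replicate (2 * n) (Cross Falling, 1) @ replicate 2 (Cross Rising, 0) @ [(Cup, 1), (Cup, 0)])
      [a, a, b, b]) = (\<Sum>a = 0..<p. \<Sum>b = 0..<p. 1)"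
    by (intro sum.cong) auto
  moreover have "colourings p ((Cap, 2) # D) [a, a] = (\<Sum>b = 0..<p. colourings p D [a, a, b, b])" for a D
    using colourings_Cap[of "[a, a]" 2 p D "[]"] by simp
  ultimately show ?thesis
    using colourings_Cap[of "[]" 0 p _ "[]"] by (simp add: two_bridge_diagram_def del: colourings.simps)
qed

lemma colourings_trivial: "colourings p trivial_diagram [] = nat p"
proof -
  have "colourings p [(Cup, 0)] [c, c] = 1" for c
    by simp
  then show ?thesis
    using colourings_Cap[of "[]" 0 p "[(Cup, 0)]" "[]"]
    by (simp add: trivial_diagram_def del: colourings.simps)
qed

lemma two_bridge_nontrivial:
  assumes "n \<ge> 1"
  shows "\<not> welded_equivalent (two_bridge_diagram (2 * n) 2) trivial_diagram"
proof
  let ?p = "4 * int n + 1"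
  assume "welded_equivalent (two_bridge_diagram (2 * n) 2) trivial_diagram"
  then have "nat ?p * nat ?p = nat ?p"
    using welded_equivalent_colourings[of ?p] colourings_two_bridge[of ?p n] colourings_trivial[of ?p]
    by simp
  then show False using assms by simp
qed

section \<open>Tangles up to welded moves\<close>

text \<open>Braid notation: the over-strand of \<open>\<sigma> i\<close> starts at position \<open>i + 1\<close>, that of \<open>\<tau> i\<close>, the inverse of
  \<open>\<sigma> i\<close>, at position \<open>i\<close>. Followed or preceded by \<open>\<omega> i\<close>, they become pure braids, each of which is one
  arrow of the Gauss diagram between two vertical strands: in \<open>\<tau> i, \<omega> i\<close> and its inverse \<open>\<omega> i, \<sigma> i\<close> strand \<open>i\<close>
  passes over strand \<open>i + 1\<close>; in \<open>\<sigma> i, \<omega> i\<close> and its inverse \<open>\<omega> i, \<tau> i\<close> strand \<open>i + 1\<close> passes over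
  strand \<open>i\<close>.\<close>

abbreviation (input) \<sigma> :: "nat \<Rightarrow> event" where "\<sigma> i \<equiv> (Cross Rising, i)"
abbreviation (input) \<tau> :: "nat \<Rightarrow> event" where "\<tau> i \<equiv> (Cross Falling, i)"
abbreviation (input) \<omega> :: "nat \<Rightarrow> event" where "\<omega> i \<equiv> (Cross Welded, i)"

text \<open>Equivalence of tangles with \<open>w\<close> strands at the top inside every diagram. The width is part of the relation
  because the empty tangle fits everywhere, whereas a pair of crossings cancelling to it does not.\<close>

definition tangle_equivalent :: "nat \<Rightarrow> diagram \<Rightarrow> diagram \<Rightarrow> bool" where
  "tangle_equivalent w D E \<longleftrightarrow> strands w D = strands w E \<and>
     (\<forall>xs ys. strands 0 xs = Some w \<longrightarrow> link_diagram (xs @ D @ ys) \<longrightarrow>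
        welded_equivalent (xs @ D @ ys) (xs @ E @ ys))"

lemma tangle_equivalent_closed:
  assumes "tangle_equivalent 0 D E" "link_diagram D"
  shows "welded_equivalent D E"
proof -
  have "\<forall>xs ys. strands 0 xs = Some 0 \<longrightarrow> link_diagram (xs @ D @ ys) \<longrightarrow>
      welded_equivalent (xs @ D @ ys) (xs @ E @ ys)"
    using assms(1) unfolding tangle_equivalent_def by (rule conjunct2)
  from this[rule_format, of "[]" "[]"] show ?thesis using assms(2) by simp
qed

lemma tangle_refl [simp]: "tangle_equivalent w D D"
  by (simp add: tangle_equivalent_def welded_equivalent_def)

lemma tangle_link_diagram:
  assumes "strands w D = strands w E" "strands 0 xs = Some w"
  shows "link_diagram (xs @ D @ ys) \<longleftrightarrow> link_diagram (xs @ E @ ys)"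
  using assms by (simp add: link_diagram_def strands_append)

lemma tangle_sym:
  assumes "tangle_equivalent w D E"
  shows "tangle_equivalent w E D"
  unfolding tangle_equivalent_def
proof (intro conjI allI impI)
  show "strands w E = strands w D"
    using assms by (simp add: tangle_equivalent_def)
  fix xs ys assume xs: "strands 0 xs = Some w" and "link_diagram (xs @ E @ ys)"
  then have "link_diagram (xs @ D @ ys)"
    using \<open>strands w E = strands w D\<close> tangle_link_diagram by blast
  then have "welded_equivalent (xs @ D @ ys) (xs @ E @ ys)"
    using assms xs by (simp add: tangle_equivalent_def)
  then show "welded_equivalent (xs @ E @ ys) (xs @ D @ ys)"
    unfolding welded_equivalent_def by (rule equivclp_sym)
qed

lemma tangle_trans [trans]:
  assumes "tangle_equivalent w D E" "tangle_equivalent w E F"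
  shows "tangle_equivalent w D F"
  unfolding tangle_equivalent_def
proof (intro conjI allI impI)
  show "strands w D = strands w F"
    using assms by (simp add: tangle_equivalent_def)
  fix xs ys assume xs: "strands 0 xs = Some w" and D: "link_diagram (xs @ D @ ys)"
  then have "link_diagram (xs @ E @ ys)"
    using tangle_link_diagram[of w D E] assms(1) by (simp add: tangle_equivalent_def)
  then have "welded_equivalent (xs @ D @ ys) (xs @ E @ ys)" "welded_equivalent (xs @ E @ ys) (xs @ F @ ys)"
    using assms xs D by (simp_all add: tangle_equivalent_def)
  then show "welded_equivalent (xs @ D @ ys) (xs @ F @ ys)"
    unfolding welded_equivalent_def by (rule equivclp_trans)
qed

lemma tangle_rule:
  assumes "isotopy_rule l r \<or> reidemeister_rule l r" "strands w l = strands w r"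
  shows "tangle_equivalent w l r"
  unfolding tangle_equivalent_def welded_equivalent_def
proof (intro conjI allI impI r_into_equivclp)
  fix xs ys assume "strands 0 xs = Some w" "link_diagram (xs @ l @ ys)"
  then show "apply_rule (\<lambda>l r. isotopy_rule l r \<or> reidemeister_rule l r) (xs @ l @ ys) (xs @ r @ ys)"
    unfolding apply_rule_def using assms(1) tangle_link_diagram[OF assms(2)] by blast
next
  show "strands w l = strands w r" by fact
qed

lemma tangle_context:
  assumes "tangle_equivalent v D E" "strands w xs = Some v"
  shows "tangle_equivalent w (xs @ D @ ys) (xs @ E @ ys)"
  unfolding tangle_equivalent_def
proof (intro conjI allI impI)
  show "strands w (xs @ D @ ys) = strands w (xs @ E @ ys)"
    using assms by (simp add: strands_append tangle_equivalent_def)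
  fix us vs assume "strands 0 us = Some w" "link_diagram (us @ (xs @ D @ ys) @ vs)"
  then have "strands 0 (us @ xs) = Some v" "link_diagram ((us @ xs) @ D @ (ys @ vs))"
    using assms by (auto simp add: strands_append)
  then have "welded_equivalent ((us @ xs) @ D @ (ys @ vs)) ((us @ xs) @ E @ (ys @ vs))"
    using assms(1) unfolding tangle_equivalent_def by blast
  then show "welded_equivalent (us @ (xs @ D @ ys) @ vs) (us @ (xs @ E @ ys) @ vs)"
    by simp
qed

text \<open>One step of a derivation: the \<open>m\<close> events of \<open>D\<close> after the first \<open>k\<close> are replaced by \<open>n\<close> events of \<open>E\<close>.\<close>

lemma tangle_at:
  assumes "take k D = take k E" "drop m (drop k D) = drop n (drop k E)"
    and "strands w (take k D) = Some v"
    and "tangle_equivalent v (take m (drop k D)) (take n (drop k E))"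
  shows "tangle_equivalent w D E"
  using tangle_context[OF assms(4,3), of "drop m (drop k D)"] assms(1,2)
  by (metis append_take_drop_id)

lemma tangle_RII:
  assumes "m' = flip m" "Suc i < w"
  shows "tangle_equivalent w [(Cross m, i), (Cross m', i)] []"
  using assms reidemeister_rule.RII[of m i] reidemeister_rule.VRII[of i]
  by (intro tangle_rule) (cases m; auto)+

lemma tangle_triangle:
  assumes "j = Suc i" "Suc j < w"
   and "(a, b, c) \<in> {(Falling, Welded, Welded), (Welded, Falling, Welded), (Welded, Welded, Falling),
     (Rising, Welded, Welded), (Welded, Rising, Welded), (Welded, Welded, Rising), (Welded, Welded, Welded),
     (Falling, Falling, Welded), (Rising, Welded, Falling), (Welded, Rising, Rising)}"
  shows "tangle_equivalent w [(Cross a, i), (Cross b, j), (Cross c, i)] [(Cross c, j), (Cross b, i), (Cross a, j)]"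
  using assms by (intro tangle_rule) (auto intro: reidemeister_rule.intros)

lemma tangle_interchange:
  assumes "i + tops e \<le> j'" "j' + bottoms e = j + tops e" "j' + tops f \<le> w"
  shows "tangle_equivalent w [(f, j'), (e, i)] [(e, i), (f, j)]"
proof (rule tangle_rule)
  obtain k where "j' = i + tops e + k" using assms(1) le_Suc_ex by blast
  moreover from this have "j = i + bottoms e + k" using assms(2) by simp
  ultimately show "isotopy_rule [(f, j'), (e, i)] [(e, i), (f, j)] \<or> reidemeister_rule [(f, j'), (e, i)] [(e, i), (f, j)]"
    using isotopy_rule.interchange by blast
  show "strands w [(f, j'), (e, i)] = strands w [(e, i), (f, j)]"
    using assms by auto
qed

lemma tangle_RI_cap: "i \<le> w \<Longrightarrow> tangle_equivalent w [(Cap, i), (Cross m, i)] [(Cap, i)]"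
  by (intro tangle_rule) (cases m; auto intro: reidemeister_rule.intros)+

lemma tangle_RI_cup: "Suc i < w \<Longrightarrow> tangle_equivalent w [(Cross m, i), (Cup, i)] [(Cup, i)]"
  by (intro tangle_rule) (cases m; auto intro: reidemeister_rule.intros)+

lemma tangle_slide_cup:
  assumes "j = Suc i" "m' = flip m" "Suc j < w"
  shows "tangle_equivalent w [(Cross m, j), (Cup, i)] [(Cross m', i), (Cup, j)]"
  using assms by (intro tangle_rule) (auto intro: isotopy_rule.intros)

lemma tangle_zigzag: "j = Suc i \<Longrightarrow> i < w \<Longrightarrow> tangle_equivalent w [(Cap, j), (Cup, i)] []"
  by (intro tangle_rule) (auto intro: isotopy_rule.intros)

lemmas tangle_moves = tangle_RII tangle_triangle tangle_interchange tangle_RI_cap tangle_RI_cup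
  tangle_slide_cup tangle_zigzag

section \<open>Commuting tails and loops\<close>

text \<open>Strand \<open>j\<close> is the over-strand on both sides, so this is the exchange of two adjacent arrow tails. Welded
  crossings carry the two arrows to a common triangle, to which \<open>F1\<close> applies in the third step.\<close>

lemma tails_commute:
  assumes "j = Suc i" "Suc j < w"
  shows "tangle_equivalent w [\<tau> j, \<omega> j, \<sigma> i, \<omega> i] [\<sigma> i, \<omega> i, \<tau> j, \<omega> j]"
proof -
  have "tangle_equivalent w [\<tau> j, \<omega> j, \<sigma> i, \<omega> i] [\<tau> j, \<omega> i, \<omega> i, \<omega> j, \<sigma> i, \<omega> i]"
    by (rule tangle_at[of 1 _ _ 0 2]) (use assms in \<open>auto intro!: tangle_moves[THEN tangle_sym]\<close>)
  also have "tangle_equivalent w \<dots> [\<tau> j, \<omega> i, \<sigma> j, \<omega> i, \<omega> j, \<omega> i]"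
    by (rule tangle_at[of 2 _ _ 3 3]) (use assms in \<open>auto intro!: tangle_moves\<close>)
  also have "tangle_equivalent w \<dots> [\<sigma> i, \<omega> j, \<tau> i, \<omega> i, \<omega> j, \<omega> i]"
    by (rule tangle_at[of 0 _ _ 3 3]) (use assms in \<open>auto intro!: tangle_moves[THEN tangle_sym]\<close>)
  also have "tangle_equivalent w \<dots> [\<sigma> i, \<omega> j, \<tau> i, \<omega> j, \<omega> i, \<omega> j]"
    by (rule tangle_at[of 3 _ _ 3 3]) (use assms in \<open>auto intro!: tangle_moves\<close>)
  also have "tangle_equivalent w \<dots> [\<sigma> i, \<omega> j, \<omega> j, \<omega> i, \<tau> j, \<omega> j]"
    by (rule tangle_at[of 2 _ _ 3 3]) (use assms in \<open>auto intro!: tangle_moves\<close>)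
  also have "tangle_equivalent w \<dots> [\<sigma> i, \<omega> i, \<tau> j, \<omega> j]"
    by (rule tangle_at[of 1 _ _ 2 0]) (use assms in \<open>auto intro!: tangle_moves\<close>)
  finally show ?thesis .
qed

lemma commute_inverse:
  assumes "tangle_equivalent w (X @ Y) (Y @ X)"
    and "tangle_equivalent w (Y @ Y') []" "tangle_equivalent w (Y' @ Y) []"
    and "strands w X = Some w" "strands w Y = Some w" "strands w Y' = Some w"
  shows "tangle_equivalent w (X @ Y') (Y' @ X)"
proof -
  have "tangle_equivalent w (X @ Y') (Y' @ Y @ X @ Y')"
    using tangle_context[OF tangle_sym[OF assms(3)], of w "[]" "X @ Y'"] by simp
  also have "tangle_equivalent w \<dots> (Y' @ X @ Y @ Y')"
    using tangle_context[OF tangle_sym[OF assms(1)], of w Y' Y'] assms by simp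
  also have "tangle_equivalent w \<dots> (Y' @ X)"
    using tangle_context[OF assms(2), of w "Y' @ X" "[]"] assms by (simp add: strands_append)
  finally show ?thesis .
qed

lemma crossing_inverse:
  assumes "Suc i < w" "m' = flip m" "n' = flip n"
  shows "tangle_equivalent w ([(Cross m, i), (Cross n, i)] @ [(Cross n', i), (Cross m', i)]) []"
proof -
  have "tangle_equivalent w [(Cross m, i), (Cross n, i), (Cross n', i), (Cross m', i)] [(Cross m, i), (Cross m', i)]"
    by (rule tangle_at[of 1 _ _ 2 0]) (use assms in \<open>auto intro!: tangle_moves\<close>)
  also have "tangle_equivalent w \<dots> []"
    using assms by (auto intro!: tangle_moves)
  finally show ?thesis by simp
qed

lemma tails_commute_inverse:
  assumes "j = Suc i" "Suc j < w"
  shows "tangle_equivalent w [\<tau> j, \<omega> j, \<omega> i, \<tau> i] [\<omega> i, \<tau> i, \<tau> j, \<omega> j]"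
proof -
  have "tangle_equivalent w ([\<tau> j, \<omega> j] @ [\<omega> i, \<tau> i]) ([\<omega> i, \<tau> i] @ [\<tau> j, \<omega> j])"
  proof (rule commute_inverse)
    show "tangle_equivalent w ([\<tau> j, \<omega> j] @ [\<sigma> i, \<omega> i]) ([\<sigma> i, \<omega> i] @ [\<tau> j, \<omega> j])"
      using tails_commute[OF assms] by simp
    show "tangle_equivalent w ([\<sigma> i, \<omega> i] @ [\<omega> i, \<tau> i]) []" "tangle_equivalent w ([\<omega> i, \<tau> i] @ [\<sigma> i, \<omega> i]) []"
      by (rule crossing_inverse; use assms in simp)+
  qed (use assms in auto)
  then show ?thesis by simp
qed

lemma tails_commute_inverses:
  assumes "j = Suc i" "Suc j < w"
  shows "tangle_equivalent w [\<omega> i, \<tau> i, \<omega> j, \<sigma> j] [\<omega> j, \<sigma> j, \<omega> i, \<tau> i]"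
proof -
  have "tangle_equivalent w ([\<omega> i, \<tau> i] @ [\<omega> j, \<sigma> j]) ([\<omega> j, \<sigma> j] @ [\<omega> i, \<tau> i])"
  proof (rule commute_inverse)
    show "tangle_equivalent w ([\<omega> i, \<tau> i] @ [\<tau> j, \<omega> j]) ([\<tau> j, \<omega> j] @ [\<omega> i, \<tau> i])"
      using tangle_sym[OF tails_commute_inverse[OF assms]] by simp
    show "tangle_equivalent w ([\<tau> j, \<omega> j] @ [\<omega> j, \<sigma> j]) []" "tangle_equivalent w ([\<omega> j, \<sigma> j] @ [\<tau> j, \<omega> j]) []"
      by (rule crossing_inverse; use assms in simp)+
  qed (use assms in auto)
  then show ?thesis by simp
qed

text \<open>Strand \<open>i\<close> passes over strand \<open>j\<close>, to which it is joined by the minimum. Between the over- and the underpass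
  of that self-crossing the curve meets only the tail of another arrow; once this tail is moved out of the way by
  \<open>F1\<close>, the self-crossing is a kink.\<close>

lemma loop_right:
  assumes "j = Suc i" "Suc j < w"
  shows "tangle_equivalent w [\<tau> i, \<omega> i, \<omega> j, \<sigma> j, (Cup, i)] [\<omega> j, \<sigma> j, (Cup, i)]"
proof -
  have "tangle_equivalent w [\<tau> i, \<omega> i, \<omega> j, \<sigma> j, (Cup, i)] [\<tau> i, \<omega> i, \<omega> j, \<tau> i, (Cup, j)]"
    by (rule tangle_at[of 3 _ _ 2 2]) (use assms in \<open>auto intro!: tangle_moves\<close>)
  also have "tangle_equivalent w \<dots> [\<tau> i, \<tau> j, \<omega> i, \<omega> j, (Cup, j)]"
    by (rule tangle_at[of 1 _ _ 3 3]) (use assms in \<open>auto intro!: tangle_moves\<close>)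
  also have "tangle_equivalent w \<dots> [\<tau> i, \<tau> j, \<omega> i, (Cup, j)]"
    by (rule tangle_at[of 3 _ _ 2 1]) (use assms in \<open>auto intro!: tangle_moves\<close>)
  also have "tangle_equivalent w \<dots> [\<omega> j, \<tau> i, \<tau> j, (Cup, j)]"
    by (rule tangle_at[of 0 _ _ 3 3]) (use assms in \<open>auto intro!: tangle_moves\<close>)
  also have "tangle_equivalent w \<dots> [\<omega> j, \<tau> i, (Cup, j)]"
    by (rule tangle_at[of 2 _ _ 2 1]) (use assms in \<open>auto intro!: tangle_moves\<close>)
  also have "tangle_equivalent w \<dots> [\<omega> j, \<sigma> j, (Cup, i)]"
    by (rule tangle_at[of 1 _ _ 2 2]) (use assms in \<open>auto intro!: tangle_moves[THEN tangle_sym]\<close>)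
  finally show ?thesis .
qed

text \<open>The tail of an arrow that ends on strand \<open>i\<close> slides through the minimum from strand \<open>j\<close> to the strand
  to the right of \<open>j\<close>. The leading \<open>\<omega> j\<close> brings the latter strand next to strand \<open>i\<close>.\<close>

lemma cup_transfer:
  assumes "j = Suc i" "Suc j < w"
  shows "tangle_equivalent w [\<sigma> i, \<omega> i, (Cup, j)] [\<omega> j, \<omega> i, \<tau> i, (Cup, j)]"
proof -
  have "tangle_equivalent w [\<sigma> i, \<omega> i, (Cup, j)] [\<sigma> i, \<omega> j, (Cup, i)]"
    by (rule tangle_at[of 1 _ _ 2 2]) (use assms in \<open>auto intro!: tangle_moves[THEN tangle_sym]\<close>)
  also have "tangle_equivalent w \<dots> [\<sigma> i, \<omega> j, \<omega> i, (Cup, i)]"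
    by (rule tangle_at[of 2 _ _ 1 2]) (use assms in \<open>auto intro!: tangle_moves[THEN tangle_sym]\<close>)
  also have "tangle_equivalent w \<dots> [\<omega> j, \<omega> i, \<sigma> j, (Cup, i)]"
    by (rule tangle_at[of 0 _ _ 3 3]) (use assms in \<open>auto intro!: tangle_moves\<close>)
  also have "tangle_equivalent w \<dots> [\<omega> j, \<omega> i, \<tau> i, (Cup, j)]"
    by (rule tangle_at[of 2 _ _ 2 2]) (use assms in \<open>auto intro!: tangle_moves\<close>)
  finally show ?thesis .
qed

text \<open>The counterpart of \<open>loop_right\<close> with the over- and underpass of the self-crossing on exchanged strands.
  Sliding the foreign tail through the minimum places it on the strand that is over in the self-crossing, where
  tails commute.\<close>

lemma loop_left:
  assumes "j = Suc i" "Suc j < w"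
  shows "tangle_equivalent w [\<omega> j, \<tau> j, \<sigma> i, \<omega> i, (Cup, j)] [\<sigma> i, \<omega> i, (Cup, j)]"
proof -
  have "tangle_equivalent w [\<omega> j, \<tau> j, \<sigma> i, \<omega> i, (Cup, j)] [\<omega> j, \<tau> j, \<omega> j, \<omega> i, \<tau> i, (Cup, j)]"
    by (rule tangle_at[of 2 _ _ 3 4]) (use assms in \<open>auto intro!: cup_transfer\<close>)
  also have "tangle_equivalent w \<dots> [\<omega> j, \<omega> i, \<tau> i, \<tau> j, \<omega> j, (Cup, j)]"
    by (rule tangle_at[of 1 _ _ 4 4]) (use assms in \<open>auto intro!: tails_commute_inverse\<close>)
  also have "tangle_equivalent w \<dots> [\<omega> j, \<omega> i, \<tau> i, \<tau> j, (Cup, j)]"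
    by (rule tangle_at[of 4 _ _ 2 1]) (use assms in \<open>auto intro!: tangle_moves\<close>)
  also have "tangle_equivalent w \<dots> [\<omega> j, \<omega> i, \<tau> i, (Cup, j)]"
    by (rule tangle_at[of 3 _ _ 2 1]) (use assms in \<open>auto intro!: tangle_moves\<close>)
  also have "tangle_equivalent w \<dots> [\<sigma> i, \<omega> i, (Cup, j)]"
    using cup_transfer[THEN tangle_sym] assms .
  finally show ?thesis .
qed

section \<open>The twisted clasp absorbs the row\<close>

text \<open>The twisted clasp in symmetric form: the arc joining the strands \<open>1\<close> and \<open>2\<close> passes over the strands \<open>0\<close>
  and \<open>3\<close>, which belong to the arc of the other minimum, and is never below.\<close>

abbreviation (input) split_clasp :: diagram where
  "split_clasp \<equiv> [\<sigma> 0, \<omega> 0, \<omega> 2, \<sigma> 2, (Cup, 1), (Cup, 0)]"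

text \<open>The strands \<open>0\<close> and \<open>1\<close> are joined to \<open>3\<close> and \<open>2\<close> by the two nested minima, so a crossing between the
  former slides along the minima to a crossing between the latter.\<close>

lemma move_crossing_right:
  "tangle_equivalent 4 [(Cross m, 0), (Cup, 1), (Cup, 0)] [(Cross m, 2), (Cup, 1), (Cup, 0)]"
proof -
  have flip: "flip (flip m) = m" by (cases m) auto
  have "tangle_equivalent 4 [(Cross m, 0), (Cup, 1), (Cup, 0)] [(Cross (flip m), 1), (Cup, 0), (Cup, 0)]"
    by (rule tangle_at[of 0 _ _ 2 2]) (auto simp: flip intro!: tangle_slide_cup[THEN tangle_sym])
  also have "tangle_equivalent 4 \<dots> [(Cross (flip m), 1), (Cup, 2), (Cup, 0)]"
    by (rule tangle_at[of 1 _ _ 2 2]) (auto intro!: tangle_moves[THEN tangle_sym])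
  also have "tangle_equivalent 4 \<dots> [(Cross m, 2), (Cup, 1), (Cup, 0)]"
    by (rule tangle_at[of 0 _ _ 2 2]) (auto simp: flip intro!: tangle_slide_cup[THEN tangle_sym])
  finally show ?thesis .
qed

lemma twisted_clasp:
  "tangle_equivalent 4 [\<sigma> 0, \<omega> 0, \<sigma> 0, \<omega> 0, (Cup, 1), (Cup, 0)] split_clasp"
proof -
  have "tangle_equivalent 4 [\<sigma> 0, \<omega> 0, \<sigma> 0, \<omega> 0, (Cup, 1), (Cup, 0)]
    [\<sigma> 0, \<omega> 0, \<sigma> 0, \<omega> 2, (Cup, 1), (Cup, 0)]"
    by (rule tangle_at[of 3 _ _ 3 3]) (auto intro: move_crossing_right[simplified])
  also have "tangle_equivalent 4 \<dots> [\<sigma> 0, \<omega> 0, \<omega> 2, \<sigma> 0, (Cup, 1), (Cup, 0)]"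
    by (rule tangle_at[of 2 _ _ 2 2]) (auto intro!: tangle_moves[THEN tangle_sym])
  also have "tangle_equivalent 4 \<dots> split_clasp"
    by (rule tangle_at[of 3 _ _ 3 3]) (auto intro: move_crossing_right[simplified])
  finally show ?thesis .
qed

lemma swap_ends:
  "tangle_equivalent 4 split_clasp [\<omega> 2, \<sigma> 2, \<sigma> 0, \<omega> 0, (Cup, 1), (Cup, 0)]"
proof -
  have "tangle_equivalent 4 split_clasp [\<sigma> 0, \<omega> 2, \<omega> 0, \<sigma> 2, (Cup, 1), (Cup, 0)]"
    by (rule tangle_at[of 1 _ _ 2 2]) (auto intro!: tangle_moves[THEN tangle_sym])
  also have "tangle_equivalent 4 \<dots> [\<omega> 2, \<sigma> 0, \<omega> 0, \<sigma> 2, (Cup, 1), (Cup, 0)]"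
    by (rule tangle_at[of 0 _ _ 2 2]) (auto intro!: tangle_moves[THEN tangle_sym])
  also have "tangle_equivalent 4 \<dots> [\<omega> 2, \<sigma> 0, \<sigma> 2, \<omega> 0, (Cup, 1), (Cup, 0)]"
    by (rule tangle_at[of 2 _ _ 2 2]) (auto intro!: tangle_moves[THEN tangle_sym])
  also have "tangle_equivalent 4 \<dots> [\<omega> 2, \<sigma> 2, \<sigma> 0, \<omega> 0, (Cup, 1), (Cup, 0)]"
    by (rule tangle_at[of 1 _ _ 2 2]) (auto intro!: tangle_moves[THEN tangle_sym])
  finally show ?thesis .
qed

text \<open>A crossing of the row together with a welded crossing is an arrow from strand \<open>1\<close> to strand \<open>2\<close>, that is,
  from the over-arc of the clasp to itself. Everything that separates it from a kink is an arrow tail.\<close>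

lemma absorb_right: "tangle_equivalent 4 (\<tau> 1 # \<omega> 1 # split_clasp) split_clasp"
proof -
  have "tangle_equivalent 4 (\<tau> 1 # \<omega> 1 # split_clasp)
    [\<sigma> 0, \<omega> 0, \<tau> 1, \<omega> 1, \<omega> 2, \<sigma> 2, (Cup, 1), (Cup, 0)]"
    by (rule tangle_at[of 0 _ _ 4 4]) (auto intro!: tails_commute)
  also have "tangle_equivalent 4 \<dots> split_clasp"
    by (rule tangle_at[of 2 _ _ 5 3]) (auto intro!: loop_right)
  finally show ?thesis .
qed

lemma absorb_left: "tangle_equivalent 4 (\<omega> 1 # \<tau> 1 # split_clasp) split_clasp"
proof -
  have "tangle_equivalent 4 (\<omega> 1 # \<tau> 1 # split_clasp)
    [\<omega> 1, \<tau> 1, \<omega> 2, \<sigma> 2, \<sigma> 0, \<omega> 0, (Cup, 1), (Cup, 0)]"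
    by (rule tangle_at[of 2 _ _ 6 6]) (auto intro!: swap_ends[simplified])
  also have "tangle_equivalent 4 \<dots> [\<omega> 2, \<sigma> 2, \<omega> 1, \<tau> 1, \<sigma> 0, \<omega> 0, (Cup, 1), (Cup, 0)]"
    by (rule tangle_at[of 0 _ _ 4 4]) (auto intro!: tails_commute_inverses)
  also have "tangle_equivalent 4 \<dots> [\<omega> 2, \<sigma> 2, \<sigma> 0, \<omega> 0, (Cup, 1), (Cup, 0)]"
    by (rule tangle_at[of 2 _ _ 5 3]) (auto intro!: loop_left)
  also have "tangle_equivalent 4 \<dots> split_clasp"
    by (rule tangle_sym[OF swap_ends])
  finally show ?thesis .
qed

text \<open>Half-twists are absorbed two at a time: inserting a cancelling pair of welded crossings turns them into two
  arrows in opposite directions between the strands \<open>1\<close> and \<open>2\<close>.\<close>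

lemma absorb_pair: "tangle_equivalent 4 (\<tau> 1 # \<tau> 1 # split_clasp) split_clasp"
proof -
  have "tangle_equivalent 4 (\<tau> 1 # \<tau> 1 # split_clasp) (\<tau> 1 # \<omega> 1 # \<omega> 1 # \<tau> 1 # split_clasp)"
    by (rule tangle_at[of 1 _ _ 0 2]) (auto intro!: tangle_moves[THEN tangle_sym])
  also have "tangle_equivalent 4 \<dots> (\<tau> 1 # \<omega> 1 # split_clasp)"
    by (rule tangle_at[of 2 _ _ 8 6]) (auto intro!: absorb_left[simplified])
  also note absorb_right
  finally show ?thesis .
qed

lemma absorb_row:
  "tangle_equivalent 4 (replicate (2 * n) (\<tau> 1) @ split_clasp) split_clasp"
proof (induction n)
  case 0
  then show ?case by simp
next
  case (Suc n)
  have "tangle_equivalent 4 (replicate (2 * Suc n) (\<tau> 1) @ split_clasp) (\<tau> 1 # \<tau> 1 # split_clasp)"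
    using tangle_context[OF Suc.IH, of 4 "[\<tau> 1, \<tau> 1]" "[]"] by simp
  also note absorb_pair
  finally show ?case .
qed

text \<open>Without the row each crossing of the clasp sits at a maximum and is removed as a kink. Exchanging the heights
  of the maxima gives access to both of them.\<close>

lemma split_clasp_trivial: "tangle_equivalent 0 ([(Cap, 0), (Cap, 2)] @ split_clasp) trivial_diagram"
proof -
  have "tangle_equivalent 0 ([(Cap, 0), (Cap, 2)] @ split_clasp) ([(Cap, 0), (Cap, 0)] @ split_clasp)"
    by (rule tangle_at[of 0 _ _ 2 2]) (auto intro!: tangle_moves[THEN tangle_sym])
  also have "tangle_equivalent 0 \<dots> [(Cap, 0), (Cap, 0), \<omega> 0, \<omega> 2, \<sigma> 2, (Cup, 1), (Cup, 0)]"
    by (rule tangle_at[of 1 _ _ 2 1]) (auto intro!: tangle_moves)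
  also have "tangle_equivalent 0 \<dots> [(Cap, 0), (Cap, 0), \<omega> 2, \<sigma> 2, (Cup, 1), (Cup, 0)]"
    by (rule tangle_at[of 1 _ _ 2 1]) (auto intro!: tangle_moves)
  also have "tangle_equivalent 0 \<dots> [(Cap, 0), (Cap, 2), \<omega> 2, \<sigma> 2, (Cup, 1), (Cup, 0)]"
    by (rule tangle_at[of 0 _ _ 2 2]) (auto intro!: tangle_moves)
  also have "tangle_equivalent 0 \<dots> [(Cap, 0), (Cap, 2), \<sigma> 2, (Cup, 1), (Cup, 0)]"
    by (rule tangle_at[of 1 _ _ 2 1]) (auto intro!: tangle_moves)
  also have "tangle_equivalent 0 \<dots> [(Cap, 0), (Cap, 2), (Cup, 1), (Cup, 0)]"
    by (rule tangle_at[of 1 _ _ 2 1]) (auto intro!: tangle_moves)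
  also have "tangle_equivalent 0 \<dots> trivial_diagram"
    unfolding trivial_diagram_def
    by (rule tangle_at[of 1 _ _ 2 0]) (auto intro!: tangle_moves)
  finally show ?thesis .
qed

lemma twisted_trivial:
  "tangle_equivalent 0 ([(Cap, 0), (Cap, 2)] @ replicate (2 * n) (\<tau> 1) @
     [\<sigma> 0, \<omega> 0, \<sigma> 0, \<omega> 0, (Cup, 1), (Cup, 0)]) trivial_diagram"
proof -
  have "tangle_equivalent 4 (replicate (2 * n) (\<tau> 1) @ [\<sigma> 0, \<omega> 0, \<sigma> 0, \<omega> 0, (Cup, 1), (Cup, 0)])
      (replicate (2 * n) (\<tau> 1) @ split_clasp)"
    using tangle_context[OF twisted_clasp strands_row[of "2 * n" Falling], where ys = "[]"] by simp
  also note absorb_row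
  finally have "tangle_equivalent 0 ([(Cap, 0), (Cap, 2)] @ replicate (2 * n) (\<tau> 1) @
     [\<sigma> 0, \<omega> 0, \<sigma> 0, \<omega> 0, (Cup, 1), (Cup, 0)]) ([(Cap, 0), (Cap, 2)] @ split_clasp)"
    using tangle_context[where w = 0 and v = 4 and xs = "[(Cap, 0), (Cap, 2)]" and ys = "[]"] by simp
  also note split_clasp_trivial
  finally show ?thesis .
qed

section \<open>The two-bridge diagram is a knot diagram\<close>

text \<open>Variants of the introduction rules in which the neighbouring indices are variables, so that they apply to
  numerals.\<close>

lemma joined_intros:
  assumes "k < length D" "D ! k = (p, i)" "k' = Suc k"
  shows "q < i \<Longrightarrow> joined D (k, q) (k', q)"
    and "i + tops p \<le> q \<Longrightarrow> q + bottoms p = q' + tops p \<Longrightarrow> joined D (k, q) (k', q')"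
    and "p = Cap \<Longrightarrow> j = Suc i \<Longrightarrow> joined D (k', i) (k', j)"
    and "p = Cup \<Longrightarrow> j = Suc i \<Longrightarrow> joined D (k, i) (k, j)"
    and "p = Cross m \<Longrightarrow> j = Suc i \<Longrightarrow> joined D (k, i) (k', j)"
    and "p = Cross m \<Longrightarrow> j = Suc i \<Longrightarrow> joined D (k, j) (k', i)"
proof -
  assume "i + tops p \<le> q" "q + bottoms p = q' + tops p"
  define r where "r = q - (i + tops p)"
  have "q = i + tops p + r" "q' = i + bottoms p + r"
    unfolding r_def using \<open>i + tops p \<le> q\<close> \<open>q + bottoms p = q' + tops p\<close> by linarith+
  then show "joined D (k, q) (k', q')"
    using joined.right[OF assms(1,2)] assms(3) by simp
next
  show "q < i \<Longrightarrow> joined D (k, q) (k', q)"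
    using joined.left[OF assms(1,2)] assms(3) by simp
  show "p = Cap \<Longrightarrow> j = Suc i \<Longrightarrow> joined D (k', i) (k', j)"
    using joined.cap[of k D i] assms by simp
  show "p = Cup \<Longrightarrow> j = Suc i \<Longrightarrow> joined D (k, i) (k, j)"
    using joined.cup[of k D i] assms by simp
  show "p = Cross m \<Longrightarrow> j = Suc i \<Longrightarrow> joined D (k, i) (k', j)"
    using joined.falling[of k D m i] assms by simp
  show "p = Cross m \<Longrightarrow> j = Suc i \<Longrightarrow> joined D (k, j) (k', i)"
    using joined.rising[of k D m i] assms by simp
qed

text \<open>An even number of half-twists, in the row and in the clasp, returns each strand to its position. Hence all
  four strands run through, and the maxima and minima join them in the cyclic order \<open>0, 1, 2, 3\<close>.\<close>

lemma knot_diagram_two_bridge: "knot_diagram (two_bridge_diagram (2 * n) 2)"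
proof -
  define D where "D = two_bridge_diagram (2 * n) 2"
  have D: "D = [(Cap, 0), (Cap, 2)] @ replicate (2 * n) (Cross Falling, 1) @
      [(Cross Rising, 0), (Cross Rising, 0), (Cup, 1), (Cup, 0)]"
  proof -
    have two: "replicate 2 e = [e, e]" for e :: event by (simp add: numeral_2_eq_2)
    show ?thesis unfolding D_def two_bridge_diagram_def two by simp
  qed
  have len: "length D = 2 * n + 6" by (simp add: D)
  have nth_top: "D ! 0 = (Cap, 0)" "D ! 1 = (Cap, 2)"
    by (simp_all add: D)
  have nth_row: "D ! (2 + k) = (Cross Falling, 1)" if "k < 2 * n" for k
    using that by (simp add: D nth_append)
  let ?m = "2 * n"
  have nth_clasp: "D ! j = [(Cross Rising, 0), (Cross Rising, 0), (Cup, 1), (Cup, 0)] ! k"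
    if "j = ?m + 2 + k" for j k
    by (simp add: D nth_append that)
  have nth_bottom: "D ! (?m + 2) = (Cross Rising, 0)" "D ! (?m + 3) = (Cross Rising, 0)"
    "D ! (?m + 4) = (Cup, 1)" "D ! (?m + 5) = (Cup, 0)"
    using nth_clasp[of "?m + 2" 0] nth_clasp[of "?m + 3" 1] nth_clasp[of "?m + 4" 2]
      nth_clasp[of "?m + 5" 3] by simp_all
  \<comment> \<open>a representative of the component of each point, which turns connectedness into equations\<close>
  define c where "c x = (SOME y. equivclp (joined D) x y)" for x
  have c: "c x = c y" if "joined D x y" for x y
  proof -
    have "equivclp (joined D) x = equivclp (joined D) y"
      using equivp_evquivclp[of "joined D"] that unfolding equivp_def by blast
    then show ?thesis by (simp add: c_def)
  qed
  have c_class: "equivclp (joined D) x (c x)" for x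
    unfolding c_def by (rule someI[of _ x]) simp
  have top: "c (1, 0) = c (1, 1)" "c (2, 2) = c (2, 3)" "c (1, 0) = c (2, 0)" "c (1, 1) = c (2, 1)"
    by (rule c, rule joined_intros[OF _ nth_top(1)] joined_intros[OF _ nth_top(2)]; simp add: len)+
  have row: "c (2 + k, 0) = c (3 + k, 0)" "c (2 + k, 2) = c (3 + k, 1)"
    "c (2 + k, 1) = c (3 + k, 2)" "c (2 + k, 3) = c (3 + k, 3)" if "k < 2 * n" for k
    by (rule c, rule joined_intros[OF _ nth_row[OF that]]; use that in \<open>simp add: len\<close>)+
  have even: "c (2 + 2 * k, q) = c (2, q)" if "k \<le> n" "q \<in> {0, 1, 2, 3}" for k q
    using that
  proof (induction k)
    case (Suc k)
    then show ?case
      using row[of "2 * k"] row[of "Suc (2 * k)"] by (auto simp: numeral_eq_Suc)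
  qed simp
  have clasp: "c (?m + 2, 1) = c (?m + 3, 0)" "c (?m + 2, 0) = c (?m + 3, 1)"
    "c (?m + 2, 2) = c (?m + 3, 2)" "c (?m + 2, 3) = c (?m + 3, 3)"
    "c (?m + 3, 1) = c (?m + 4, 0)" "c (?m + 3, 0) = c (?m + 4, 1)"
    "c (?m + 3, 2) = c (?m + 4, 2)" "c (?m + 3, 3) = c (?m + 4, 3)"
    by (rule c, rule joined_intros[OF _ nth_bottom(1)] joined_intros[OF _ nth_bottom(2)]; simp add: len)+
  have bottom: "c (?m + 4, 1) = c (?m + 4, 2)" "c (?m + 5, 0) = c (?m + 5, 1)"
    "c (?m + 4, 0) = c (?m + 5, 0)" "c (?m + 4, 3) = c (?m + 5, 1)"
    by (rule c, rule joined_intros[OF _ nth_bottom(3)] joined_intros[OF _ nth_bottom(4)]; simp add: len)+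
  have "c (2, 1) = c (2, 2)"
    using even[of n 1] even[of n 2] clasp(1,3,6,7) bottom(1) by (simp add: add.commute)
  then have level2: "c (2, q) = c (2, 0)" if "q \<in> {0, 1, 2, 3}" for q
    using that top by auto
  have level: "c (2 + k, q) = c (2, 0)" if "k \<le> 2 * n" "q \<in> {0, 1, 2, 3}" for k q
    using that
  proof (induction k arbitrary: q)
    case 0
    then show ?case using level2[of q] by simp
  next
    case (Suc k)
    then have "k < 2 * n" by simp
    note r = row[OF this]
    have IH: "c (2 + k, r) = c (2, 0)" if "r \<in> {0, 1, 2, 3}" for r
      by (rule Suc.IH[OF _ that]) (use \<open>k < 2 * n\<close> in simp)
    have "c (3 + k, 0) = c (2, 0)" "c (3 + k, 1) = c (2, 0)" "c (3 + k, 2) = c (2, 0)" "c (3 + k, 3) = c (2, 0)"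
      unfolding r[symmetric] by (rule IH; simp)+
    moreover have "2 + Suc k = 3 + k" by simp
    ultimately show ?case using Suc.prems(2) by (elim insertE emptyE) (simp_all only:)
  qed
  have take_clasp: "take j D = [(Cap, 0), (Cap, 2)] @ replicate ?m (Cross Falling, 1) @
      take k [(Cross Rising, 0), (Cross Rising, 0), (Cup, 1), (Cup, 0)]" if "j = ?m + 2 + k" for j k
    by (simp add: D that)
  have points: "c x = c (2, 0)" if x_point: "x \<in> points D" for x
  proof -
    obtain k q where x: "x = (k, q)" and k: "k \<le> length D" and q: "q < the (strands 0 (take k D))"
      using x_point by (auto simp: points_def)
    consider "k = 0" | "k = 1" | j where "k = 2 + j" "j \<le> 2 * n" | "k = ?m + 3" | "k = ?m + 4"
      | "k = ?m + 5" | "k = ?m + 6"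
    proof -
      have cases: "k = 0 \<or> k = 1 \<or> (k = 2 + (k - 2) \<and> k - 2 \<le> 2 * n) \<or> k = ?m + 3 \<or> k = ?m + 4 \<or> k = ?m + 5 \<or> k = ?m + 6"
        using k len by linarith
      show thesis using cases by (elim disjE conjE) (fact that)+
    qed
    then show ?thesis
    proof cases
      case 1
      then show ?thesis using q by simp
    next
      case 2
      then have "q < 2" using q by (simp add: D)
      then have "q = 0 \<or> q = 1" by auto
      then show ?thesis using top x 2 by auto
    next
      case (3 j)
      then have "take k D = [(Cap, 0), (Cap, 2)] @ replicate j (Cross Falling, 1)"
        by (simp add: D)
      then have "q < 4" using q strands_row[of j Falling] by (simp add: numeral_eq_Suc)
      then have "q \<in> {0, 1, 2, 3}" by auto
      then show ?thesis using level[of j q] x 3 by simp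
    next
      case 4
      then have "take k D = [(Cap, 0), (Cap, 2)] @ replicate ?m (Cross Falling, 1) @ [(Cross Rising, 0)]"
        using take_clasp[of k 1] by simp
      then have "q < 4" using q strands_row[of ?m Falling] by (simp add: strands_append numeral_eq_Suc)
      then have "q \<in> {0, 1, 2, 3}" by auto
      then show ?thesis
        using clasp level[of ?m 0] level[of ?m 1] level[of ?m 2] level[of ?m 3] x 4
        by (auto simp: add.commute)
    next
      case 5
      then have "take k D = [(Cap, 0), (Cap, 2)] @ replicate ?m (Cross Falling, 1) @ [(Cross Rising, 0), (Cross Rising, 0)]"
        using take_clasp[of k 2] by simp
      then have "q < 4" using q strands_row[of ?m Falling] by (simp add: strands_append numeral_eq_Suc)
      then have "q \<in> {0, 1, 2, 3}" by auto
      then show ?thesis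
        using clasp level[of ?m 0] level[of ?m 1] level[of ?m 2] level[of ?m 3] x 5
        by (auto simp: add.commute)
    next
      case 6
      then have "take k D = [(Cap, 0), (Cap, 2)] @ replicate ?m (Cross Falling, 1) @ [(Cross Rising, 0), (Cross Rising, 0), (Cup, 1)]"
        using take_clasp[of k 3] by simp
      then have "q < 2" using q strands_row[of ?m Falling] by (simp add: strands_append numeral_eq_Suc)
      then have "q \<in> {0, 1}" by auto
      then show ?thesis using clasp bottom level[of ?m 0] level[of ?m 1] x 6 by (auto simp: add.commute)
    next
      case 7
      then have "take k D = D" using len by simp
      then have "q < 0" using q strands_row[of ?m Falling] by (simp add: strands_append D numeral_eq_Suc)
      then show ?thesis by simp
    qed
  qed
  have "equivclp (joined D) x y" if "x \<in> points D" "y \<in> points D" for x y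
    using c_class[of x] equivclp_sym[OF c_class[of y]] unfolding points[OF that(1)] points[OF that(2)]
    by (rule equivclp_trans)
  moreover have "link_diagram D"
    using strands_row[of ?m Falling] by (simp add: link_diagram_def D strands_append numeral_eq_Suc)
  ultimately show ?thesis
    unfolding D_def[symmetric] knot_diagram_def by (auto simp: D)
qed

section \<open>The unknotting twist number\<close>

text \<open>The second crossing of the clasp is twisted in place, so the planar isotopies before and after the twist
  are identities.\<close>

lemma two_bridge_twist:
  obtains D' where "twist_move (two_bridge_diagram (2 * n) 2) D'"
    and "welded_equivalent trivial_diagram D'"
proof -
  let ?xs = "[(Cap, 0), (Cap, 2)] @ replicate (2 * n) (\<tau> 1) @ [\<sigma> 0]"
  let ?ys = "[(Cup, 1), (Cup, 0)]"
  let ?D' = "?xs @ [\<omega> 0, \<sigma> 0, \<omega> 0] @ ?ys"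
  have D: "two_bridge_diagram (2 * n) 2 = ?xs @ [\<sigma> 0] @ ?ys"
  proof -
    have two: "replicate 2 e = [e, e]" for e :: event by (simp add: numeral_2_eq_2)
    show ?thesis unfolding two_bridge_diagram_def two by simp
  qed
  have link: "link_diagram (?xs @ [\<sigma> 0] @ ?ys)" "link_diagram ?D'"
    using strands_row[of "2 * n" Falling] by (simp_all add: link_diagram_def strands_append numeral_eq_Suc)
  have "twist_rule [\<sigma> 0] [\<omega> 0, \<sigma> 0, \<omega> 0]"
    by (rule twist_rule.twist) simp
  then have "apply_rule twist_rule (two_bridge_diagram (2 * n) 2) ?D'"
    unfolding apply_rule_def D using link
    by (intro conjI exI[of _ ?xs] exI[of _ "[\<sigma> 0]"] exI[of _ "[\<omega> 0, \<sigma> 0, \<omega> 0]"] exI[of _ ?ys] refl)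
  then have "twist_move (two_bridge_diagram (2 * n) 2) ?D'"
    unfolding twist_move_def planar_isotopic_def
    by (intro exI[of _ "two_bridge_diagram (2 * n) 2"] exI[of _ ?D'] conjI disjI1 equivclp_refl)
  moreover have "welded_equivalent ?D' trivial_diagram"
    using tangle_equivalent_closed[OF twisted_trivial[of n]] link(2) by simp
  then have "welded_equivalent trivial_diagram ?D'"
    unfolding welded_equivalent_def by (rule equivclp_sym)
  ultimately show thesis by (rule that)
qed

theorem proposition4p1:
  fixes n :: nat
  assumes "n \<ge> 1"
  shows "ut (welded_class (two_bridge_diagram (2 * n) 2)) = 1"
proof (rule antisym)
  let ?D = "two_bridge_diagram (2 * n) 2"
  obtain D' where "twist_move ?D D'" "welded_equivalent trivial_diagram D'"
    by (rule two_bridge_twist)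
  then have "\<exists>D'. (twist_move ^^ 1) ?D D' \<and> welded_equivalent trivial_diagram D'"
    unfolding relpowp_1 by blast
  then have "ut_diagram ?D \<le> enat 1"
    unfolding ut_diagram_def by (intro INF_lower) simp
  moreover have "?D \<in> welded_class ?D"
    by (simp add: welded_class_def knot_diagram_two_bridge welded_equivalent_def)
  then have "ut (welded_class ?D) \<le> ut_diagram ?D"
    unfolding ut_def by (rule INF_lower)
  ultimately show "ut (welded_class ?D) \<le> 1"
    by (simp add: one_enat_def)
next
  let ?D = "two_bridge_diagram (2 * n) 2"
  have "k \<noteq> 0" if "welded_equivalent ?D E" "(twist_move ^^ k) E E'" "welded_equivalent trivial_diagram E'"
    for E E' k
  proof
    assume "k = 0"
    then have "welded_equivalent ?D trivial_diagram"
      using that unfolding welded_equivalent_def by (auto dest: equivclp_sym intro: equivclp_trans)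
    then show False using two_bridge_nontrivial[OF assms] by simp
  qed
  then show "1 \<le> ut (welded_class ?D)"
    unfolding ut_def ut_diagram_def welded_class_def one_enat_def
    by (intro INF_greatest) (fastforce simp: Suc_le_eq)
qed

end
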